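(* Given $s_0\in\mathcal S$, the optimal value function $y_0\mapsto\hat J_0^*(s_0,y_0)$ on $\mathcal Y$ is piecewise quadratic concave, and it is divided into quadratic concave segments by the break points. That is, there are finitely many break points, and on each of the subintervals into which the break points divide $\mathcal Y$, $\hat J_0^*(s_0,\cdot)$ coincides with a concave quadratic function of $y_0$ (a concave polynomial of degree at most two).
   Context: $\mathcal T=\{0,1,\ldots,T-1\}$ with $T<\infty$; $\mathcal S,\mathcal A$ are finite state and action spaces; $\mathcal A(s)\subset\mathcal A$ is the (nonempty) set of admissible actions at $s$, with $\cup_s\mathcal A(s)=\mathcal A$; $\mathcal K=\{(s,a):s\in\mathcal S,a\in\mathcal A(s)\}$; $P_t(\cdot|s,a)$ is a transition probability on $\mathcal S$ for each $(s,a)\in\mathcal K$, $t\in\mathcal T$; $r_t:\mathcal K\to\mathbb R$ is the reward function, with minimum $\underline r$ and maximum $\bar r$ (over all $t$ and $(s,a)$); $\mathcal Y=[T\underline r,T\bar r]$. A history-dependent randomized policy $u=(u_t)\in\mathcal U^{\rm HR}$ consists of probability distributions $u_t(\cdot|h_t)$ on $\mathcal A(s_t)$ given $h_t=(s_0,a_0,\ldots,s_{t-1},a_{t-1},s_t)$; $\mathcal U^{\rm HD}$ is the subset of history-dependent deterministic policies. $R_{0:T}=\sum_{\tau=0}^{T-1}r_\tau(s_\tau,a_\tau)$; $\lambda\ge0$ is fixed; $\hat J_0^u(s_0,y_0)=\mathbb E^u_{s_0}[R_{0:T}-\lambda(R_{0:T}-y_0)^2]$; $\hat J_0^*(s_0,y_0)=\sup_{u\in\mathcal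 U^{\rm HR}}\hat J_0^u(s_0,y_0)$, which is attained in $\mathcal U^{\rm HD}$. The pseudo mean-variance MDP $\hat{\mathcal M}(y)$ is the problem of maximizing $\hat J_0^u(s_0,y)$ over policies $u$; for the given $s_0$, $u$ is optimal for $\hat{\mathcal M}(y)$ if $\hat J_0^u(s_0,y)=\hat J_0^*(s_0,y)$. Break point (for the given $s_0$): $y^c\in\mathcal Y$ is a break point if there exist $y_1<y^c<y_2$ such that the problems $\hat{\mathcal M}(y)$, $y\in[y_1,y^c]$, have the same optimal policy (one deterministic policy in $\mathcal U^{\rm HD}$ is optimal for all of them), while this policy is not optimal for $\hat{\mathcal M}(y)$, $y\in(y^c,y_2]$. *)

theory Defs
  imports "HOL-Probability.Probability"
begin

text \<open>
  The state space is the finite type \<open>'s\<close> and the action space the finite type \<open>'a\<close>.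
  Kernels and rewards are total functions; only their values at stages \<open>t < horizon M\<close> and at
  admissible pairs are ever used.
\<close>

record ('s, 'a) mdp =
  horizon :: nat
  admissible :: "'s \<Rightarrow> 'a set"
  trans_prob :: "nat \<Rightarrow> 's \<Rightarrow> 'a \<Rightarrow> 's pmf"
  reward :: "nat \<Rightarrow> 's \<Rightarrow> 'a \<Rightarrow> real"

definition valid_mdp :: "('s::finite, 'a::finite) mdp \<Rightarrow> bool" where
  "valid_mdp M \<longleftrightarrow> (\<forall>s. admissible M s \<noteq> {}) \<and> (\<Union>s. admissible M s) = UNIV"

definition state_action_pairs :: "('s::finite, 'a::finite) mdp \<Rightarrow> ('s \<times> 'a) set" where
  "state_action_pairs M = {(s, a). a \<in> admissible M s}"

definition reward_values :: "('s::finite, 'a::finite) mdp \<Rightarrow> real set" where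
  "reward_values M =
    {reward M t s a | t s a. t < horizon M \<and> (s, a) \<in> state_action_pairs M}"

definition y_min :: "('s::finite, 'a::finite) mdp \<Rightarrow> real" where
  "y_min M = real (horizon M) * Min (reward_values M)"

definition y_max :: "('s::finite, 'a::finite) mdp \<Rightarrow> real" where
  "y_max M = real (horizon M) * Max (reward_values M)"

text \<open>For \<open>horizon M = 0\<close> the set of rewards is empty, but both bounds are then \<open>0\<close>.\<close>

definition Y_set :: "('s::finite, 'a::finite) mdp \<Rightarrow> real set" where
  "Y_set M = {y_min M..y_max M}"

text \<open>
  A history \<open>(s\<^sub>0, a\<^sub>0, \<dots>, s\<^bsub>t-1\<^esub>, a\<^bsub>t-1\<^esub>, s\<^sub>t)\<close> is the list of its past state-action pairs,
  oldest first, together with the current state. The stage \<open>t\<close> is the length of that list,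
  so a policy needs no separate stage argument.
\<close>

type_synonym ('s, 'a) policy = "('s \<times> 'a) list \<Rightarrow> 's \<Rightarrow> 'a pmf"

definition decision_pasts :: "('s::finite, 'a::finite) mdp \<Rightarrow> ('s \<times> 'a) list set" where
  "decision_pasts M = {h. length h < horizon M \<and> set h \<subseteq> state_action_pairs M}"

definition HR_policies :: "('s::finite, 'a::finite) mdp \<Rightarrow> ('s, 'a) policy set" where
  "HR_policies M = {u. \<forall>h \<in> decision_pasts M. \<forall>s. set_pmf (u h s) \<subseteq> admissible M s}"

definition HD_policies :: "('s::finite, 'a::finite) mdp \<Rightarrow> ('s, 'a) policy set" where
  "HD_policies M =
    {u \<in> HR_policies M. \<forall>h \<in> decision_pasts M. \<forall>s. \<exists>a. u h s = return_pmf a}"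

text \<open>The law of the history at stage \<open>t\<close> when starting in \<open>s\<^sub>0\<close> and following \<open>u\<close>.\<close>

primrec history_pmf ::
  "('s::finite, 'a::finite) mdp \<Rightarrow> ('s, 'a) policy \<Rightarrow> 's \<Rightarrow> nat \<Rightarrow> (('s \<times> 'a) list \<times> 's) pmf"
where
  "history_pmf M u s0 0 = return_pmf ([], s0)"
| "history_pmf M u s0 (Suc t) =
    bind_pmf (history_pmf M u s0 t) (\<lambda>(h, s).
      bind_pmf (u h s) (\<lambda>a.
        map_pmf (\<lambda>s'. (h @ [(s, a)], s')) (trans_prob M t s a)))"

definition total_reward :: "('s::finite, 'a::finite) mdp \<Rightarrow> ('s \<times> 'a) list \<Rightarrow> real" where
  "total_reward M h = (\<Sum>\<tau><horizon M. reward M \<tau> (fst (h ! \<tau>)) (snd (h ! \<tau>)))"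

definition J_hat ::
  "('s::finite, 'a::finite) mdp \<Rightarrow> real \<Rightarrow> ('s, 'a) policy \<Rightarrow> 's \<Rightarrow> real \<Rightarrow> real" where
  "J_hat M lam u s0 y0 =
    measure_pmf.expectation (history_pmf M u s0 (horizon M))
      (\<lambda>(h, s). total_reward M h - lam * (total_reward M h - y0)\<^sup>2)"

definition J_hat_opt :: "('s::finite, 'a::finite) mdp \<Rightarrow> real \<Rightarrow> 's \<Rightarrow> real \<Rightarrow> real" where
  "J_hat_opt M lam s0 y0 = (SUP u \<in> HR_policies M. J_hat M lam u s0 y0)"

definition optimal_policy ::
  "('s::finite, 'a::finite) mdp \<Rightarrow> real \<Rightarrow> 's \<Rightarrow> real \<Rightarrow> ('s, 'a) policy \<Rightarrow> bool" where
  "optimal_policy M lam s0 y u \<longleftrightarrow>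
    u \<in> HR_policies M \<and> J_hat M lam u s0 y = J_hat_opt M lam s0 y"

text \<open>
  The witnesses \<open>y1\<close> and \<open>y2\<close> range over all reals, so an end point of \<^term>\<open>Y_set M\<close> may be a
  break point; this does not affect how the break points divide the interval.
\<close>

definition break_points :: "('s::finite, 'a::finite) mdp \<Rightarrow> real \<Rightarrow> 's \<Rightarrow> real set" where
  "break_points M lam s0 =
    {yc \<in> Y_set M. \<exists>y1 y2. y1 < yc \<and> yc < y2 \<and>
      (\<exists>u \<in> HD_policies M.
        (\<forall>y \<in> {y1..yc}. optimal_policy M lam s0 y u) \<and>
        (\<forall>y \<in> {yc<..y2}. \<not> optimal_policy M lam s0 y u))}"

text \<open>
  The closed subintervals into which the points of \<open>B\<close> divide \<open>{a..b}\<close>. Admitting \<open>c = d\<close> adds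
  only singletons, and yields the expected single piece when \<open>a = b\<close>.
\<close>

definition subintervals :: "real set \<Rightarrow> real \<Rightarrow> real \<Rightarrow> real set set" where
  "subintervals B a b =
    {{c..d} | c d. c \<in> B \<union> {a, b} \<and> d \<in> B \<union> {a, b} \<and> c \<le> d \<and> {c<..<d} \<inter> B = {}}"

definition quadratic_concave_on :: "real set \<Rightarrow> (real \<Rightarrow> real) \<Rightarrow> bool" where
  "quadratic_concave_on I f \<longleftrightarrow>
    (\<exists>p :: real poly. degree p \<le> 2 \<and> concave_on UNIV (poly p) \<and> (\<forall>y \<in> I. f y = poly p y))"

end

theory Submission
  imports Defs
begin

text \<open>
  For each policy \<open>u\<close>, adding \<open>lam * y\<^sup>2\<close> to \<open>J_hat M lam u s0 y\<close> leaves an affine function of \<open>y\<close>.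
  By backward induction the supremum is attained by deterministic policies, which induce only
  finitely many laws of the history; so \<open>J_hat_opt M lam s0 y + lam * y\<^sup>2\<close> is the maximum of
  finitely many affine functions. Each of them is maximal on an interval, whose right end is the only
  break point it can account for. Conversely, an affine function that is maximal immediately to the
  right of a point remains maximal up to the next break point.
\<close>

section \<open>Maxima of finitely many affine functions\<close>

text \<open>A pair \<open>(p, q)\<close> stands for the affine function \<open>p + q * y\<close>.
  Membership of \<open>l\<close> in \<open>L\<close> is kept out of the predicate and stated
  separately where it matters.\<close>

definition maximal_at :: "(real \<times> real) set \<Rightarrow> real \<times> real \<Rightarrow> real \<Rightarrow> bool" where
  "maximal_at L l y \<longleftrightarrow> (\<forall>l' \<in> L. fst l' + snd l' * y \<le> fst l + snd l * y)"

text \<open>The difference of the two functions is monotone in \<open>y\<close>, so its sign at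
  \<open>y\<close> is inherited from \<open>x\<close> when \<open>q' \<le> q\<close> and from
  \<open>z\<close> otherwise.\<close>

lemma affine_le_between:
  fixes p q p' q' x y z :: real
  assumes "p' + q' * x \<le> p + q * x" "p' + q' * z \<le> p + q * z" "x \<le> y" "y \<le> z"
  shows "p' + q' * y \<le> p + q * y"
proof (cases "q' \<le> q")
  case True
  have "(q - q') * x \<le> (q - q') * y" using True assms(3) by (intro mult_left_mono) auto
  then show ?thesis using assms(1) by (simp add: algebra_simps)
next
  case False
  have "(q' - q) * y \<le> (q' - q) * z" using False assms(4) by (intro mult_left_mono) auto
  then show ?thesis using assms(2) by (simp add: algebra_simps)
qed

lemma maximal_at_between:
  assumes "maximal_at L l x" "maximal_at L l z" "x \<le> y" "y \<le> z"
  shows "maximal_at L l y"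
  using assms unfolding maximal_at_def by (auto intro: affine_le_between[of _ _ x _ _ z])

lemma closed_maximal_at: "closed {y. maximal_at L l y}"
proof -
  have "{y. maximal_at L l y} = (\<Inter>l'\<in>L. {y. fst l' + snd l' * y \<le> fst l + snd l * y})"
    by (auto simp: maximal_at_def)
  then show ?thesis
    by (auto intro!: closed_INT closed_Collect_le continuous_intros)
qed

text \<open>Among the functions that attain the maximum at \<open>c\<close>, take one of largest
  slope. It dominates the others tied at \<open>c\<close> everywhere to the right, and those
  strictly below at \<open>c\<close> stay below near \<open>c\<close> by continuity; finiteness of
  \<open>L\<close> gives a common neighbourhood.\<close>

lemma maximal_at_right:
  assumes "finite L" "L \<noteq> {}" "c < d"
  obtains l e where "l \<in> L" "c < e" "e < d" "maximal_at L l c" "maximal_at L l e"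
proof -
  define v where "v l = fst l + snd l * c" for l :: "real \<times> real"
  define C where "C = {l \<in> L. v l = Max (v ` L)}"
  have "Max (v ` L) \<in> v ` L" using assms by (intro Max_in) auto
  then obtain l0 where "l0 \<in> L" "v l0 = Max (v ` L)" by force
  then have "l0 \<in> C" by (simp add: C_def)
  then have C: "C \<noteq> {}" "finite C" using assms(1) by blast (simp add: C_def assms(1))
  then have "Max (snd ` C) \<in> snd ` C" by (intro Max_in) auto
  then obtain l where l: "l \<in> C" "snd l = Max (snd ` C)" by auto
  have le: "v l' \<le> v l" if "l' \<in> L" for l'
    using that l(1) assms by (auto simp: C_def)
  have slope: "snd l' \<le> snd l" if "l' \<in> L" "v l' = v l" for l'
    using that l C by (auto simp: C_def)
  have "\<forall>\<^sub>F y in at_right c. fst l' + snd l' * y \<le> fst l + snd l * y" if "l' \<in> L" for l'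
  proof (cases "v l' = v l")
    case True
    have "fst l' + snd l' * y \<le> fst l + snd l * y" if "y > c" for y
    proof -
      have "(snd l - snd l') * c \<le> (snd l - snd l') * y"
        using slope[OF \<open>l' \<in> L\<close> True] that by (intro mult_left_mono) auto
      then show ?thesis using True by (simp add: v_def algebra_simps)
    qed
    then show ?thesis by (auto simp: eventually_at_right_field intro: exI[of _ "c + 1"])
  next
    case False
    then have lt: "fst l' + snd l' * c < fst l + snd l * c"
      using le[OF that] by (simp add: v_def)
    have "((\<lambda>y. (fst l + snd l * y) - (fst l' + snd l' * y)) \<longlongrightarrow>
        (fst l + snd l * c) - (fst l' + snd l' * c)) (at_right c)"
      by (intro tendsto_intros)
    from order_tendstoD(1)[OF this, of 0] lt
    show ?thesis by (auto elim: eventually_mono)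
  qed
  then have "\<forall>\<^sub>F y in at_right c. maximal_at L l y"
    unfolding maximal_at_def using assms(1) by (intro eventually_ball_finite) auto
  moreover have "\<forall>\<^sub>F y in at_right c. y \<in> {c<..<d}"
    using assms(3) by (rule eventually_at_right_real)
  ultimately have "\<forall>\<^sub>F y in at_right c. maximal_at L l y \<and> y \<in> {c<..<d}"
    by (rule eventually_conj)
  then have "\<exists>e. maximal_at L l e \<and> e \<in> {c<..<d}"
    by (intro eventually_happens'[of "at_right c"]) auto
  then obtain e where "maximal_at L l e" "c < e" "e < d" by auto
  moreover have "l \<in> L" using l by (simp add: C_def)
  moreover have "maximal_at L l c" using le by (simp add: maximal_at_def v_def)
  ultimately show ?thesis by (intro that)
qed

text \<open>The counterpart of \<open>break_points\<close> with coefficient pairs in place of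
  policies and no restriction to \<open>Y_set\<close>.\<close>

definition affine_breaks :: "(real \<times> real) set \<Rightarrow> real set" where
  "affine_breaks L = {yc. \<exists>y1 y2. y1 < yc \<and> yc < y2 \<and>
     (\<exists>l\<in>L. (\<forall>y\<in>{y1..yc}. maximal_at L l y) \<and> (\<forall>y\<in>{yc<..y2}. \<not> maximal_at L l y))}"

text \<open>Each \<open>l\<close> accounts for at most one break: it is maximal on an interval, and
  a break due to \<open>l\<close> must be the right end of that interval.\<close>

lemma finite_affine_breaks:
  assumes "finite L"
  shows "finite (affine_breaks L)"
proof -
  \<comment> \<open>Of the condition to the left of \<open>yc\<close>, only maximality at
    \<open>yc\<close> itself is kept; this already determines \<open>yc\<close> from
    \<open>l\<close>.\<close>
  define R where "R l yc \<longleftrightarrow> (\<exists>y2>yc. maximal_at L l yc \<and> (\<forall>y\<in>{yc<..y2}. \<not> maximal_at L l y))"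
    for l yc
  have not_less: "\<not> x < z" if "R l x" "R l z" for l x z
  proof
    assume "x < z"
    from that obtain y2 where y2: "y2 > x" "maximal_at L l x" "maximal_at L l z"
      "\<forall>y\<in>{x<..y2}. \<not> maximal_at L l y" by (auto simp: R_def)
    \<comment> \<open>The point lies between \<open>x\<close> and \<open>z\<close>, where
      \<open>l\<close> is maximal, but also in \<open>{x<..y2}\<close>, where it is not.\<close>
    have "maximal_at L l (min y2 z)"
      by (rule maximal_at_between[OF y2(2,3)]) (use y2 \<open>x < z\<close> in auto)
    then show False using y2 \<open>x < z\<close> by auto
  qed
  have "finite {yc. R l yc}" for l
  proof (cases "\<exists>x. R l x")
    case True
    then obtain x where "R l x" by blast
    have "{yc. R l yc} \<subseteq> {x}"
    proof
      fix z assume "z \<in> {yc. R l yc}"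
      then show "z \<in> {x}" using not_less[of l x z] not_less[of l z x] \<open>R l x\<close> by simp
    qed
    then show ?thesis by (rule finite_subset) simp
  qed simp
  then have "finite (\<Union>l\<in>L. {yc. R l yc})" using assms by simp
  moreover have "affine_breaks L \<subseteq> (\<Union>l\<in>L. {yc. R l yc})"
  proof
    fix yc assume "yc \<in> affine_breaks L"
    then obtain y1 y2 l where *: "y1 < yc" "yc < y2" "l \<in> L"
      "\<forall>y\<in>{y1..yc}. maximal_at L l y" "\<forall>y\<in>{yc<..y2}. \<not> maximal_at L l y"
      unfolding affine_breaks_def by blast
    from *(1,4) have "maximal_at L l yc" by simp
    then show "yc \<in> (\<Union>l\<in>L. {yc. R l yc})" using * unfolding R_def by blast
  qed
  ultimately show ?thesis by (rule finite_subset[rotated])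
qed

text \<open>Start with an \<open>l\<close> that is maximal at \<open>c\<close> and slightly to the
  right of it, and let \<open>m\<close> be the last point of \<open>{c..d}\<close> at which it is
  maximal. If \<open>m < d\<close>, then \<open>m\<close> would be a break strictly between
  \<open>c\<close> and \<open>d\<close>.\<close>

lemma maximal_at_between_breaks:
  assumes "finite L" "L \<noteq> {}" "c \<le> d" "{c<..<d} \<inter> affine_breaks L = {}"
  obtains l where "l \<in> L" "\<forall>y\<in>{c..d}. maximal_at L l y"
proof (cases "c = d")
  case True
  obtain l where "l \<in> L" "maximal_at L l c"
    by (rule maximal_at_right[OF assms(1,2), of c "c + 1"]) auto
  then show ?thesis using True by (intro that) auto
next
  case False
  with assms(3) have "c < d" by simp
  then obtain l e where l: "l \<in> L" "c < e" "e < d" "maximal_at L l c" "maximal_at L l e"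
    using maximal_at_right[OF assms(1,2)] by blast
  let ?S = "{c..d} \<inter> {y. maximal_at L l y}"
  have "compact ?S" by (intro compact_Int_closed closed_maximal_at compact_Icc)
  moreover have "e \<in> ?S" using l by simp
  ultimately obtain m where m: "m \<in> ?S" "\<And>y. y \<in> ?S \<Longrightarrow> y \<le> m"
    using compact_attains_sup by (metis empty_iff)
  \<comment> \<open>This yields \<open>c < m\<close>, the room to the left of \<open>m\<close> that
    the definition of a break demands.\<close>
  have "e \<le> m" using l by (intro m(2)) auto
  have max: "maximal_at L l y" if "y \<in> {c..m}" for y
    using maximal_at_between[OF l(4), of m y] m(1) that by auto
  have "m = d"
  proof (rule ccontr)
    assume "m \<noteq> d"
    then have "m < d" using m(1) by auto
    moreover have "c < m" using l \<open>e \<le> m\<close> by simp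
    moreover have "\<forall>y\<in>{m<..d}. \<not> maximal_at L l y" 
    proof
      fix y assume "y \<in> {m<..d}"
      then show "\<not> maximal_at L l y" using m(2)[of y] \<open>c < m\<close> by auto
    qed
    ultimately have "m \<in> affine_breaks L"
      unfolding affine_breaks_def using l(1) max by blast
    then show False using assms(4) \<open>c < m\<close> \<open>m < d\<close> by auto
  qed
  then show ?thesis using l(1) max by (intro that) auto
qed

section \<open>Histories under a policy\<close>

lemma finite_set_history_pmf: "finite (set_pmf (history_pmf M u s0 t))"
  by (induction t) (auto simp: case_prod_beta)

lemma integrable_history_pmf:
  fixes f :: "_ \<Rightarrow> real"
  shows "integrable (measure_pmf (history_pmf M u s0 t)) f"
  by (intro integrable_measure_pmf_finite finite_set_history_pmf)

text \<open>The bound on \<open>t\<close> enters because policies are constrained only on pasts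
  shorter than the horizon; the induction shows that every past met before stage \<open>t\<close> is
  of this kind.\<close>

lemma set_history_pmf:
  assumes "u \<in> HR_policies M" "t \<le> horizon M" "(h, s) \<in> set_pmf (history_pmf M u s0 t)"
  shows "length h = t" "set h \<subseteq> state_action_pairs M"
proof -
  have "length h = t \<and> set h \<subseteq> state_action_pairs M" using assms(2,3)
  proof (induction t arbitrary: h s)
    case (Suc t)
    from Suc.prems(2) obtain h' s' a where *: "(h', s') \<in> set_pmf (history_pmf M u s0 t)"
      "a \<in> set_pmf (u h' s')" "h = h' @ [(s', a)]"
      by (auto simp: case_prod_beta)
    from Suc.IH[OF _ *(1)] Suc.prems(1)
    have h': "length h' = t" "set h' \<subseteq> state_action_pairs M" by auto
    then have "h' \<in> decision_pasts M" using Suc.prems(1) by (simp add: decision_pasts_def)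
    then have "a \<in> admissible M s'" using assms(1) *(2) by (auto simp: HR_policies_def)
    then show ?case using h' *(3) by (auto simp: state_action_pairs_def)
  qed auto
  then show "length h = t" "set h \<subseteq> state_action_pairs M" by auto
qed

lemma set_history_pmf_decision_pasts:
  assumes "u \<in> HR_policies M" "t < horizon M" "(h, s) \<in> set_pmf (history_pmf M u s0 t)"
  shows "h \<in> decision_pasts M"
  using set_history_pmf[OF assms(1) _ assms(3)] assms(2) by (auto simp: decision_pasts_def)

section \<open>Backward induction over histories\<close>

text \<open>No one-stage reward is added: the whole payoff is a function of the final history, as
  the squared term is not additive over stages. The stage is read off from the length of the
  past.\<close>

definition q_value ::
  "('s::finite, 'a::finite) mdp \<Rightarrow> (('s \<times> 'a) list \<times> 's \<Rightarrow> real) \<Rightarrow>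
    ('s \<times> 'a) list \<Rightarrow> 's \<Rightarrow> 'a \<Rightarrow> real" where
  "q_value M v h s a =
    measure_pmf.expectation (trans_prob M (length h) s a) (\<lambda>s'. v (h @ [(s, a)], s'))"

lemma expectation_bind_pmf_finite:
  fixes f :: "'b \<Rightarrow> real"
  assumes "finite (set_pmf p)" "\<And>x. x \<in> set_pmf p \<Longrightarrow> finite (set_pmf (k x))"
  shows "measure_pmf.expectation (bind_pmf p k) f =
    measure_pmf.expectation p (\<lambda>x. measure_pmf.expectation (k x) f)"
proof -
  have "measure_pmf.expectation (bind_pmf p k) f =
      (\<Sum>x\<in>set_pmf p. pmf p x *\<^sub>R measure_pmf.expectation (k x) f)"
    using assms by (intro pmf_expectation_bind) auto
  also have "\<dots> = measure_pmf.expectation p (\<lambda>x. measure_pmf.expectation (k x) f)"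
    by (subst integral_measure_pmf[OF assms(1)]) (auto simp: set_pmf_iff)
  finally show ?thesis .
qed

lemma expectation_history_pmf_Suc:
  assumes "u \<in> HR_policies M" "t < horizon M"
  shows "measure_pmf.expectation (history_pmf M u s0 (Suc t)) v =
    measure_pmf.expectation (history_pmf M u s0 t)
      (\<lambda>(h, s). measure_pmf.expectation (u h s) (q_value M v h s))"
proof -
  have "measure_pmf.expectation (history_pmf M u s0 (Suc t)) v =
    measure_pmf.expectation (history_pmf M u s0 t)
      (\<lambda>(h, s). measure_pmf.expectation (u h s) (\<lambda>a.
        measure_pmf.expectation (trans_prob M t s a) (\<lambda>s'. v (h @ [(s, a)], s'))))"
    by (simp add: case_prod_unfold expectation_bind_pmf_finite finite_set_history_pmf)
  also have "\<dots> = measure_pmf.expectation (history_pmf M u s0 t)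
      (\<lambda>(h, s). measure_pmf.expectation (u h s) (q_value M v h s))"
  proof (intro integral_cong_AE)
    \<comment> \<open>On the support of the law at stage \<open>t\<close>, the stage used by
      \<open>q_value\<close> agrees with \<open>t\<close>.\<close>
    have "length h = t" if "(h, s) \<in> set_pmf (history_pmf M u s0 t)" for h s
      using set_history_pmf(1)[OF assms(1) _ that] assms(2) by simp
    then show "AE x in measure_pmf (history_pmf M u s0 t).
      (case x of (h, s) \<Rightarrow> measure_pmf.expectation (u h s) (\<lambda>a.
        measure_pmf.expectation (trans_prob M t s a) (\<lambda>s'. v (h @ [(s, a)], s')))) =
      (case x of (h, s) \<Rightarrow> measure_pmf.expectation (u h s) (q_value M v h s))"
      by (auto simp: AE_measure_pmf_iff q_value_def[abs_def])
  qed auto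
  finally show ?thesis .
qed

text \<open>The Bellman recursion with histories as states and terminal payoff \<open>f\<close>; the
  number counts the stages still to go.\<close>

primrec opt_value ::
  "('s::finite, 'a::finite) mdp \<Rightarrow> (('s \<times> 'a) list \<times> 's \<Rightarrow> real) \<Rightarrow> nat \<Rightarrow>
    ('s \<times> 'a) list \<times> 's \<Rightarrow> real" where
  "opt_value M f 0 = f"
| "opt_value M f (Suc k) = (\<lambda>(h, s). Max (q_value M (opt_value M f k) h s ` admissible M s))"

text \<open>Along any policy the expected optimal value of the remaining stages cannot increase,
  since an average of \<open>q_value\<close> over admissible actions is at most their maximum. At
  \<open>t = horizon M\<close> the left-hand side is the expected payoff.\<close>

lemma expectation_opt_value_le:
  assumes "u \<in> HR_policies M" "t \<le> horizon M"
  shows "measure_pmf.expectation (history_pmf M u s0 t) (opt_value M f (horizon M - t))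
    \<le> opt_value M f (horizon M) ([], s0)"
  using assms(2)
proof (induction t)
  case (Suc t)
  let ?v = "opt_value M f (horizon M - Suc t)"
  have eq: "horizon M - t = Suc (horizon M - Suc t)" using Suc.prems by simp
  have "measure_pmf.expectation (history_pmf M u s0 (Suc t)) ?v =
      measure_pmf.expectation (history_pmf M u s0 t)
        (\<lambda>(h, s). measure_pmf.expectation (u h s) (q_value M ?v h s))"
    using Suc.prems assms(1) by (intro expectation_history_pmf_Suc) auto
  also have "\<dots> \<le> measure_pmf.expectation (history_pmf M u s0 t) (opt_value M f (horizon M - t))"
  proof (intro integral_mono_AE integrable_history_pmf)
    have "measure_pmf.expectation (u h s) (q_value M ?v h s) \<le> opt_value M f (horizon M - t) (h, s)"
      if "(h, s) \<in> set_pmf (history_pmf M u s0 t)" for h s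
    proof -
      have "h \<in> decision_pasts M"
        using set_history_pmf_decision_pasts[OF assms(1) _ that] Suc.prems by simp
      then have "set_pmf (u h s) \<subseteq> admissible M s" using assms(1) by (auto simp: HR_policies_def)
      then have "measure_pmf.expectation (u h s) (q_value M ?v h s) \<le>
          measure_pmf.expectation (u h s) (\<lambda>_. opt_value M f (horizon M - t) (h, s))"
        unfolding eq
        by (intro integral_mono_AE integrable_measure_pmf_finite)
          (auto simp: AE_measure_pmf_iff intro!: Max_ge)
      then show ?thesis by simp
    qed
    then show "AE x in measure_pmf (history_pmf M u s0 t).
      (case x of (h, s) \<Rightarrow> measure_pmf.expectation (u h s) (q_value M ?v h s)) \<le>
        opt_value M f (horizon M - t) x"
      by (auto simp: AE_measure_pmf_iff)
  qed
  also have "\<dots> \<le> opt_value M f (horizon M) ([], s0)" using Suc by simp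
  finally show ?case .
qed simp

text \<open>Choosing a maximizing action after every history turns each inequality of
  \<open>expectation_opt_value_le\<close> into an equality.\<close>

lemma greedy_policy_exists:
  assumes "valid_mdp M"
  obtains u where "u \<in> HD_policies M"
    "\<And>s0 t. t \<le> horizon M \<Longrightarrow>
      measure_pmf.expectation (history_pmf M u s0 t) (opt_value M f (horizon M - t)) =
        opt_value M f (horizon M) ([], s0)"
proof -
  \<comment> \<open>The action taken after the past \<open>h\<close> leads to stage
    \<open>Suc (length h)\<close>, so the continuation value is that of the stages left from
    there.\<close>
  define v where "v h = opt_value M f (horizon M - Suc (length h))" for h :: "('a \<times> 'b) list"
  have "\<exists>a. a \<in> admissible M s \<and>
      q_value M (v h) h s a = Max (q_value M (v h) h s ` admissible M s)" for h s
  proof -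
    have "Max (q_value M (v h) h s ` admissible M s) \<in> q_value M (v h) h s ` admissible M s"
      using assms by (intro Max_in) (auto simp: valid_mdp_def)
    then show ?thesis by auto
  qed
  then have "\<forall>h s. \<exists>a. a \<in> admissible M s \<and>
      q_value M (v h) h s a = Max (q_value M (v h) h s ` admissible M s)"
    by blast
  then obtain g where "\<forall>h s. g h s \<in> admissible M s \<and>
      q_value M (v h) h s (g h s) = Max (q_value M (v h) h s ` admissible M s)"
    unfolding choice_iff by blast
  then have g: "\<And>h s. g h s \<in> admissible M s"
    "\<And>h s. q_value M (v h) h s (g h s) = Max (q_value M (v h) h s ` admissible M s)"
    by blast+
  define u where "u h s = return_pmf (g h s)" for h s
  have HD: "u \<in> HD_policies M" using g(1) by (auto simp: HD_policies_def HR_policies_def u_def)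
  then have HR: "u \<in> HR_policies M" by (simp add: HD_policies_def)
  have "measure_pmf.expectation (history_pmf M u s0 t) (opt_value M f (horizon M - t)) =
      opt_value M f (horizon M) ([], s0)" if "t \<le> horizon M" for s0 t
    using that
  proof (induction t)
    case (Suc t)
    let ?v = "opt_value M f (horizon M - Suc t)"
    have eq: "horizon M - t = Suc (horizon M - Suc t)" using Suc.prems by simp
    have "measure_pmf.expectation (history_pmf M u s0 (Suc t)) ?v =
        measure_pmf.expectation (history_pmf M u s0 t)
          (\<lambda>(h, s). measure_pmf.expectation (u h s) (q_value M ?v h s))"
      using Suc.prems HR by (intro expectation_history_pmf_Suc) auto
    also have "\<dots> = measure_pmf.expectation (history_pmf M u s0 t) (opt_value M f (horizon M - t))"
    proof (intro integral_cong_AE)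
      have "measure_pmf.expectation (u h s) (q_value M ?v h s) = opt_value M f (horizon M - t) (h, s)"
        if "(h, s) \<in> set_pmf (history_pmf M u s0 t)" for h s
      proof -
        have "v h = ?v" using set_history_pmf(1)[OF HR _ that] Suc.prems by (simp add: v_def)
        then show ?thesis using g(2)[of h s] unfolding eq by (simp add: u_def)
      qed
      then show "AE x in measure_pmf (history_pmf M u s0 t).
        (case x of (h, s) \<Rightarrow> measure_pmf.expectation (u h s) (q_value M ?v h s)) =
          opt_value M f (horizon M - t) x"
        by (auto simp: AE_measure_pmf_iff)
    qed auto
    also have "\<dots> = opt_value M f (horizon M) ([], s0)" using Suc by simp
    finally show ?case .
  qed simp
  with HD show ?thesis by (rule that)
qed

text \<open>At the final stage \<open>opt_value M f 0\<close> is \<open>f\<close>, so the value at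
  the initial history bounds the expected payoff of every policy and is attained by the greedy
  one.\<close>

lemma HD_policy_maximizes_expectation:
  fixes f :: "('s::finite \<times> 'a::finite) list \<times> 's \<Rightarrow> real"
  assumes "valid_mdp M"
  obtains u where "u \<in> HD_policies M"
    "\<And>u'. u' \<in> HR_policies M \<Longrightarrow>
      measure_pmf.expectation (history_pmf M u' s0 (horizon M)) f \<le>
      measure_pmf.expectation (history_pmf M u s0 (horizon M)) f"
proof -
  obtain u where u: "u \<in> HD_policies M"
    "\<And>t. t \<le> horizon M \<Longrightarrow>
      measure_pmf.expectation (history_pmf M u s0 t) (opt_value M f (horizon M - t)) =
        opt_value M f (horizon M) ([], s0)"
    using greedy_policy_exists[OF assms, of f] by metis
  from u(2)[of "horizon M"] expectation_opt_value_le[of _ M "horizon M" s0 f]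
  show ?thesis by (intro that[OF u(1)]) simp
qed

section \<open>Finitely many laws from deterministic policies\<close>

lemma history_pmf_cong:
  assumes "u \<in> HR_policies M" "\<And>h s. h \<in> decision_pasts M \<Longrightarrow> u h s = u' h s" "t \<le> horizon M"
  shows "history_pmf M u s0 t = history_pmf M u' s0 t"
  using assms(3)
proof (induction t)
  case (Suc t)
  have "history_pmf M u s0 (Suc t) =
      bind_pmf (history_pmf M u s0 t) (\<lambda>(h, s). bind_pmf (u' h s) (\<lambda>a.
        map_pmf (\<lambda>s'. (h @ [(s, a)], s')) (trans_prob M t s a)))"
    unfolding history_pmf.simps
  proof (rule bind_pmf_cong[OF refl], clarify)
    fix h s assume "(h, s) \<in> set_pmf (history_pmf M u s0 t)"
    then have "u h s = u' h s"
      using set_history_pmf_decision_pasts[OF assms(1)] Suc.prems assms(2)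
      by (meson Suc_le_eq)
    then show "bind_pmf (u h s) (\<lambda>a.
          map_pmf (\<lambda>s'. (h @ [(s, a)], s')) (trans_prob M t s a)) =
        bind_pmf (u' h s) (\<lambda>a.
          map_pmf (\<lambda>s'. (h @ [(s, a)], s')) (trans_prob M t s a))"
      by simp
  qed
  with Suc show ?case by simp
qed simp

lemma finite_decision_pasts: "finite (decision_pasts M)"
proof (rule finite_subset)
  show "decision_pasts M \<subseteq> {h. set h \<subseteq> UNIV \<and> length h \<le> horizon M}"
    by (auto simp: decision_pasts_def)
  show "finite {h :: ('a \<times> 'b) list. set h \<subseteq> UNIV \<and> length h \<le> horizon M}"
    by (rule finite_lists_length_le) simp
qed

text \<open>\<open>HD_policies M\<close> itself may be infinite, as policies are arbitrary off
  \<open>decision_pasts M\<close>. The law depends only on the restriction to this finite set, where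
  each value is one of finitely many point masses.\<close>

lemma finite_HD_history_pmf:
  "finite ((\<lambda>u. history_pmf M u s0 (horizon M)) ` HD_policies M)"
proof -
  let ?D = "decision_pasts M \<times> (UNIV :: 'a set)"
  define F where "F u = restrict (\<lambda>(h, s). u h s) ?D" for u :: "('a, 'b) policy"
  have "F ` HD_policies M \<subseteq> ?D \<rightarrow>\<^sub>E range return_pmf"
  proof (rule image_subsetI)
    fix u assume "u \<in> HD_policies M"
    then have "u h s \<in> range return_pmf" if "h \<in> decision_pasts M" for h s
      using that by (simp add: HD_policies_def image_iff)
    then show "F u \<in> ?D \<rightarrow>\<^sub>E range return_pmf"
      unfolding F_def restrict_PiE_iff by auto
  qed
  moreover have "finite (?D \<rightarrow>\<^sub>E range (return_pmf :: 'b \<Rightarrow> 'b pmf))"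
    by (rule finite_PiE) (simp_all add: finite_decision_pasts)
  ultimately have fin: "finite (F ` HD_policies M)" by (rule finite_subset)
  have inj: "history_pmf M u s0 (horizon M) = history_pmf M u' s0 (horizon M)"
    if "u \<in> HD_policies M" "F u = F u'" for u u'
  proof (rule history_pmf_cong)
    show "u \<in> HR_policies M" using that by (simp add: HD_policies_def)
    show "u h s = u' h s" if "h \<in> decision_pasts M" for h s
      using fun_cong[OF \<open>F u = F u'\<close>, of "(h, s)"] that by (simp add: F_def)
  qed simp
  \<comment> \<open>A choice of a policy with restriction \<open>x\<close>; by \<open>inj\<close>
    the law does not depend on it, so the law factors through \<open>F\<close>.\<close>
  define G where "G x = history_pmf M (SOME u. u \<in> HD_policies M \<and> F u = x) s0 (horizon M)" for x
  have "history_pmf M u s0 (horizon M) = G (F u)" if "u \<in> HD_policies M" for u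
  proof -
    have "(SOME u'. u' \<in> HD_policies M \<and> F u' = F u) \<in> HD_policies M \<and>
        F (SOME u'. u' \<in> HD_policies M \<and> F u' = F u) = F u"
      by (rule someI[of _ u]) (use that in auto)
    then show ?thesis unfolding G_def by (intro inj[OF that]) simp
  qed
  then have "(\<lambda>u. history_pmf M u s0 (horizon M)) ` HD_policies M = G ` F ` HD_policies M"
    by (auto simp: image_image)
  then show ?thesis using fin by simp
qed

section \<open>The objective as a function of \<open>y\<close>\<close>

text \<open>With \<open>R\<close> the total reward, \<open>R - lam * (R - y)\<^sup>2 = (R - lam *
  R\<^sup>2) + 2 * lam * R * y - lam * y\<^sup>2\<close>. The pair holds the expected coefficients
  of the affine part; the last term is common to all policies.\<close>

definition affine_coeffs ::
  "('s::finite, 'a::finite) mdp \<Rightarrow> real \<Rightarrow> 's \<Rightarrow> ('s, 'a) policy \<Rightarrow> real \<times> real" where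
  "affine_coeffs M lam s0 u =
    (let E = measure_pmf.expectation (history_pmf M u s0 (horizon M)) in
      (E (\<lambda>(h, s). total_reward M h - lam * (total_reward M h)\<^sup>2),
       2 * lam * E (\<lambda>(h, s). total_reward M h)))"

lemma J_hat_affine:
  "J_hat M lam u s0 y =
    fst (affine_coeffs M lam s0 u) + snd (affine_coeffs M lam s0 u) * y - lam * y\<^sup>2"
proof -
  let ?E = "measure_pmf.expectation (history_pmf M u s0 (horizon M))"
  define r where "r = (\<lambda>x :: ('a \<times> 'b) list \<times> 'a. total_reward M (fst x))"
  have "J_hat M lam u s0 y = ?E (\<lambda>x. (r x - lam * (r x)\<^sup>2) + (2 * lam * y) * r x - lam * y\<^sup>2)"
    unfolding J_hat_def r_def case_prod_unfold
    by (intro Bochner_Integration.integral_cong) (auto simp: power2_eq_square algebra_simps)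
  also have "\<dots> = ?E (\<lambda>x. r x - lam * (r x)\<^sup>2) + (2 * lam * y) * ?E r - lam * y\<^sup>2"
    \<comment> \<open>Linearity of the expectation; every integrability condition holds because the
      law has finite support.\<close>
    by (subst Bochner_Integration.integral_diff Bochner_Integration.integral_add
        integral_mult_right_zero; (rule integrable_history_pmf)?)+ simp
  finally show ?thesis
    by (simp add: affine_coeffs_def Let_def r_def case_prod_unfold mult_ac)
qed

lemma finite_HD_affine_coeffs: "finite (affine_coeffs M lam s0 ` HD_policies M)"
proof -
  define G where "G p =
     (measure_pmf.expectation p (\<lambda>(h, s). total_reward M h - lam * (total_reward M h)\<^sup>2),
      2 * lam * measure_pmf.expectation p (\<lambda>(h, s). total_reward M h))"
    for p :: "(('a \<times> 'b) list \<times> 'a) pmf"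
  have "affine_coeffs M lam s0 ` HD_policies M =
      G ` (\<lambda>u. history_pmf M u s0 (horizon M)) ` HD_policies M"
    by (simp add: image_image affine_coeffs_def G_def Let_def)
  then show ?thesis using finite_HD_history_pmf[of M s0] by simp
qed

text \<open>For fixed \<open>y\<close> the objective is the expectation of one function of the final
  history, so backward induction supplies a maximizer, and the supremum is its value.\<close>

lemma HD_policy_attains_J_hat_opt:
  assumes "valid_mdp M"
  obtains u where "u \<in> HD_policies M" "J_hat_opt M lam s0 y = J_hat M lam u s0 y"
    "\<And>u'. u' \<in> HR_policies M \<Longrightarrow> J_hat M lam u' s0 y \<le> J_hat M lam u s0 y"
proof -
  obtain u where u: "u \<in> HD_policies M"
    "\<And>u'. u' \<in> HR_policies M \<Longrightarrow> J_hat M lam u' s0 y \<le> J_hat M lam u s0 y"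
    unfolding J_hat_def by (rule HD_policy_maximizes_expectation[OF assms]) blast
  moreover have "J_hat_opt M lam s0 y = J_hat M lam u s0 y"
    unfolding J_hat_opt_def using u by (intro cSup_eq_maximum) (auto simp: HD_policies_def)
  ultimately show ?thesis by (intro that)
qed

text \<open>Since a deterministic policy attains the supremum, comparison with deterministic
  policies suffices; the common term \<open>lam * y\<^sup>2\<close> then cancels.\<close>

lemma optimal_policy_iff_maximal_at:
  assumes "valid_mdp M" "u \<in> HD_policies M"
  shows "optimal_policy M lam s0 y u \<longleftrightarrow>
    maximal_at (affine_coeffs M lam s0 ` HD_policies M) (affine_coeffs M lam s0 u) y"
proof -
  obtain v where v: "v \<in> HD_policies M" "J_hat_opt M lam s0 y = J_hat M lam v s0 y"
    "\<And>u'. u' \<in> HR_policies M \<Longrightarrow> J_hat M lam u' s0 y \<le> J_hat M lam v s0 y"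
    using HD_policy_attains_J_hat_opt[OF assms(1)] by blast
  have HR: "u' \<in> HR_policies M" if "u' \<in> HD_policies M" for u'
    using that by (simp add: HD_policies_def)
  have "optimal_policy M lam s0 y u \<longleftrightarrow>
      (\<forall>u'\<in>HD_policies M. J_hat M lam u' s0 y \<le> J_hat M lam u s0 y)"
  proof
    assume "optimal_policy M lam s0 y u"
    then show "\<forall>u'\<in>HD_policies M. J_hat M lam u' s0 y \<le> J_hat M lam u s0 y"
      using v(3) HR by (simp add: optimal_policy_def v(2))
  next
    assume "\<forall>u'\<in>HD_policies M. J_hat M lam u' s0 y \<le> J_hat M lam u s0 y"
    then have "J_hat M lam v s0 y \<le> J_hat M lam u s0 y" using v(1) by simp
    then show "optimal_policy M lam s0 y u"
      using v(3)[OF HR[OF assms(2)]] HR[OF assms(2)] by (simp add: optimal_policy_def v(2))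
  qed
  then show ?thesis by (simp add: maximal_at_def J_hat_affine)
qed

lemma break_points_eq:
  assumes "valid_mdp M"
  shows "break_points M lam s0 =
    Y_set M \<inter> affine_breaks (affine_coeffs M lam s0 ` HD_policies M)"
  unfolding break_points_def affine_breaks_def
  using optimal_policy_iff_maximal_at[OF assms] by (auto cong: bex_cong)

section \<open>The pieces of the optimal value function\<close>

text \<open>Needed to place both end points in \<open>Y_set M\<close>. The case split is due to
  \<open>Min\<close> and \<open>Max\<close> of the empty set at horizon \<open>0\<close>, where the
  factor \<open>0\<close> makes both bounds vanish.\<close>

lemma y_min_le_y_max:
  assumes "valid_mdp M"
  shows "y_min M \<le> y_max M"
proof (cases "horizon M = 0")
  case False
  have "reward_values M \<subseteq>
      (\<lambda>(t, s, a). reward M t s a) ` ({..<horizon M} \<times> UNIV \<times> UNIV)"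
  proof
    fix x assume "x \<in> reward_values M"
    then obtain t s a where "x = reward M t s a" "t < horizon M" by (auto simp: reward_values_def)
    then show "x \<in> (\<lambda>(t, s, a). reward M t s a) ` ({..<horizon M} \<times> UNIV \<times> UNIV)"
      by (intro image_eqI[of _ _ "(t, s, a)"]) auto
  qed
  then have "finite (reward_values M)" by (rule finite_subset) auto
  moreover
  obtain a where "a \<in> admissible M undefined"
    using assms unfolding valid_mdp_def by blast
  then have "reward M 0 undefined a \<in> reward_values M"
    using False by (auto simp: reward_values_def state_action_pairs_def)
  then have "reward_values M \<noteq> {}" by blast
  ultimately have "Min (reward_values M) \<le> Max (reward_values M)" by simp
  then show ?thesis unfolding y_min_def y_max_def by (intro mult_left_mono) auto
qed (simp add: y_min_def y_max_def)

text \<open>The negated polynomial has a nondecreasing derivative and is therefore convex.\<close>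

lemma concave_on_quadratic:
  fixes a b c :: real
  assumes "c \<le> 0"
  shows "concave_on UNIV (poly [:a, b, c:])"
  unfolding concave_on_def
proof (rule convex_on_realI)
  show "((\<lambda>x. - poly [:a, b, c:] x) has_real_derivative - b - 2 * c * x) (at x)" for x
    by (auto intro!: derivative_eq_intros simp: algebra_simps)
  show "- b - 2 * c * x \<le> - b - 2 * c * y" if "x \<le> y" for x y
    using mult_left_mono_neg[OF that assms] by simp
qed auto

theorem theorem5:
  fixes M :: "('s::finite, 'a::finite) mdp" and lam :: real and s0 :: 's
  assumes "valid_mdp M" and "lam \<ge> 0"
  shows "finite (break_points M lam s0) \<and>
    (\<forall>I \<in> subintervals (break_points M lam s0) (y_min M) (y_max M).
      quadratic_concave_on I (J_hat_opt M lam s0))"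
proof (intro conjI ballI)
  let ?L = "affine_coeffs M lam s0 ` HD_policies M"
  show "finite (break_points M lam s0)"
    by (simp add: break_points_eq[OF assms(1)] finite_affine_breaks finite_HD_affine_coeffs)
  fix I assume "I \<in> subintervals (break_points M lam s0) (y_min M) (y_max M)"
  then obtain c d where I: "I = {c..d}" "c \<le> d"
    and cd: "c \<in> break_points M lam s0 \<union> {y_min M, y_max M}"
      "d \<in> break_points M lam s0 \<union> {y_min M, y_max M}"
    and disj: "{c<..<d} \<inter> break_points M lam s0 = {}"
    by (auto simp: subintervals_def)
  have "c \<in> Y_set M" "d \<in> Y_set M"
    using cd y_min_le_y_max[OF assms(1)] by (auto simp: break_points_def Y_set_def)
  \<comment> \<open>Inside \<open>Y_set M\<close> the breaks of the affine family are exactly the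
    break points, so none lies strictly between \<open>c\<close> and \<open>d\<close>.\<close>
  then have "{c<..<d} \<subseteq> Y_set M" by (auto simp: Y_set_def)
  with disj have "{c<..<d} \<inter> affine_breaks ?L = {}"
    by (auto simp: break_points_eq[OF assms(1)])
  moreover have "?L \<noteq> {}" using HD_policy_attains_J_hat_opt[OF assms(1)] by blast
  ultimately obtain l where "l \<in> ?L" "\<forall>y\<in>{c..d}. maximal_at ?L l y"
    using maximal_at_between_breaks[OF finite_HD_affine_coeffs _ I(2)] by metis
  then obtain u where u: "u \<in> HD_policies M"
    "\<forall>y\<in>{c..d}. maximal_at ?L (affine_coeffs M lam s0 u) y"
    by auto
  \<comment> \<open>The policy \<open>u\<close> is optimal on the whole of \<open>I\<close>, so its
    objective is the quadratic sought. Its leading coefficient \<open>- lam\<close> is nonpositive;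
    for \<open>lam = 0\<close> the piece is affine.\<close>
  define p where
    "p = [:fst (affine_coeffs M lam s0 u), snd (affine_coeffs M lam s0 u), - lam:]"
  have "J_hat_opt M lam s0 y = poly p y" if "y \<in> I" for y
  proof -
    have "optimal_policy M lam s0 y u"
      using that u I optimal_policy_iff_maximal_at[OF assms(1) u(1)] by blast
    then have "J_hat_opt M lam s0 y = J_hat M lam u s0 y" by (simp add: optimal_policy_def)
    then show ?thesis by (simp add: J_hat_affine p_def power2_eq_square algebra_simps)
  qed
  moreover have "degree p \<le> 2" by (simp add: p_def)
  moreover have "concave_on UNIV (poly p)"
    unfolding p_def using assms(2) by (intro concave_on_quadratic) simp
  ultimately show "quadratic_concave_on I (J_hat_opt M lam s0)"
    unfolding quadratic_concave_on_def by blast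
qed

end
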